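(* Let $T,N\ge1$, let $\mathcal G$ be a finite nonempty set of functions $g:\mathcal X\times\Gamma_N\to[-1,1]$, let $\eta\in(0,1/4]$ and $\delta\in(0,1)$. Run the approachability algorithm for $T$ rounds on $\mathcal G$ with rate $\eta$, against any nonanticipating environment. Then, with probability at least $1-\delta$, simultaneously for every $g\in\mathcal G$, $$\mathrm{Bias}_T(g)\le2\eta\,\mathrm{Mass}_T(g)+\frac{\log(|\mathcal G|/\delta)+2T/N^2}{\eta}.$$
   Context: $\Gamma_N=\{0,1/N,\dots,1\}$. Online protocol: at round $t=1,\dots,T$, nature reveals $x_t\in\mathcal X$; the learner announces a distribution $\psi_t$ on $\Gamma_N$; the learner privately draws $p_t\sim\psi_t$; nature reveals $y_t\in\{0,1\}$. The environment is adaptive and nonanticipating: $x_t$ and $y_t$ may depend arbitrarily (possibly randomly) on the past, and $y_t$ also on $x_t,\psi_t$, but $y_t$ cannot depend on the fresh draw $p_t$. For a transcript, $\mathrm{Bias}_T(g)=\sum_{t=1}^T(y_t-p_t)g(x_t,p_t)$ and $\mathrm{Mass}_T(g)=\sum_{t=1}^Tg(x_t,p_t)^2$. Approachability algorithm on $\mathcal G$ with rate $\eta$: initialize $W_1(g)=1/|\mathcal G|$. At round $t$, after observing $x_t$, set $w_t(g)=W_t(g)/\sum_{g'}W_t(g')$ and $F_t(\gamma)=\sum_{g\in\mathcal G}w_t(g)g(x_t,\gamma)$ for $\gamma\in\Gamma_N$. If $F_t(0)\le0$, set $\psi_t=\delta_0$ (point mass at $0$). Otherwise, if $F_t(1)\ge0$,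 set $\psi_t=\delta_1$. Otherwise choose adjacent grid points $a<b=a+1/N$ with $F_t(a)\ge0\ge F_t(b)$; if $F_t(a)=0$ or $F_t(b)=0$, let $\psi_t$ be the point mass on an endpoint where $F_t$ is zero; else set $\lambda_t=F_t(a)/(F_t(a)-F_t(b))$ and $\psi_t=(1-\lambda_t)\delta_a+\lambda_t\delta_b$. Draw $p_t\sim\psi_t$, observe $y_t$, and update $$W_{t+1}(g)=W_t(g)\exp\!\big(\eta(y_t-p_t)g(x_t,p_t)-2\eta^2g(x_t,p_t)^2\big).$$ *)

theory Defs
  imports "HOL-Probability.Probability"
begin

definition grid :: "nat \<Rightarrow> real set" where
  "grid N = {real k / real N | k. k \<le> N}"

text \<open>
  Rounds are numbered \<open>0, \<dots>, T - 1\<close>. All quantities of round \<open>t\<close> are random variables on one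
  probability space \<open>M\<close>, which also carries any private randomness of the environment. The
  \<open>\<sigma>\<close>-algebra \<open>H t\<close> is the information present in round \<open>t\<close> immediately before the fresh draw
  \<open>p t\<close>: the past, the context \<open>x t\<close>, the announced distribution \<open>\<psi> t\<close>, and also the outcome
  \<open>y t\<close>. The outcome is revealed only afterwards, but it may not depend on the draw; this is
  expressed by \<open>y t\<close> being \<open>H t\<close>-measurable while \<open>p t\<close> has conditional law \<open>\<psi> t\<close> given \<open>H t\<close>.
  Nothing else restricts how \<open>x t\<close> and \<open>y t\<close> are chosen.

  The measurable space \<open>X\<close> has the context space as its carrier.
\<close>

locale online_protocol = prob_space M for M :: "'w measure" +
  fixes H :: "nat \<Rightarrow> 'w measure"
    and X :: "'x measure"
    and N T :: nat
    and x :: "nat \<Rightarrow> 'w \<Rightarrow> 'x"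
    and \<psi> :: "nat \<Rightarrow> 'w \<Rightarrow> real pmf"
    and p y :: "nat \<Rightarrow> 'w \<Rightarrow> real"
  assumes subalgebra_H: "t \<le> T \<Longrightarrow> subalgebra M (H t)"
    and mono_H: "s \<le> t \<Longrightarrow> t \<le> T \<Longrightarrow> subalgebra (H t) (H s)"
    and context_measurable: "t < T \<Longrightarrow> x t \<in> measurable (H t) X"
    and announced_measurable: "t < T \<Longrightarrow> (\<lambda>\<omega>. pmf (\<psi> t \<omega>) \<gamma>) \<in> borel_measurable (H t)"
    and announced_support: "t < T \<Longrightarrow> \<omega> \<in> space M \<Longrightarrow> set_pmf (\<psi> t \<omega>) \<subseteq> grid N"
    and outcome_measurable: "t < T \<Longrightarrow> y t \<in> measurable (H t) (count_space {0, 1})"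
    and draw_measurable: "t < T \<Longrightarrow> p t \<in> measurable (H (Suc t)) (count_space (grid N))"
    and fresh_draw: "t < T \<Longrightarrow> \<gamma> \<in> grid N \<Longrightarrow>
      AE \<omega> in M. real_cond_exp M (H t) (indicat_real {\<omega>' \<in> space M. p t \<omega>' = \<gamma>}) \<omega>
                 = pmf (\<psi> t \<omega>) \<gamma>"

text \<open>
  The following are functions of a single transcript, i.e. of sequences \<open>x\<close>, \<open>p\<close>, \<open>y\<close> of contexts,
  predictions and outcomes.
\<close>

definition Bias ::
  "nat \<Rightarrow> (nat \<Rightarrow> 'x) \<Rightarrow> (nat \<Rightarrow> real) \<Rightarrow> (nat \<Rightarrow> real) \<Rightarrow> ('x \<times> real \<Rightarrow> real) \<Rightarrow> real" where
  "Bias T x p y g = (\<Sum>t<T. (y t - p t) * g (x t, p t))"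

definition Mass ::
  "nat \<Rightarrow> (nat \<Rightarrow> 'x) \<Rightarrow> (nat \<Rightarrow> real) \<Rightarrow> ('x \<times> real \<Rightarrow> real) \<Rightarrow> real" where
  "Mass T x p g = (\<Sum>t<T. (g (x t, p t))\<^sup>2)"

primrec weight ::
  "('x \<times> real \<Rightarrow> real) set \<Rightarrow> real \<Rightarrow> (nat \<Rightarrow> 'x) \<Rightarrow> (nat \<Rightarrow> real) \<Rightarrow> (nat \<Rightarrow> real)
    \<Rightarrow> nat \<Rightarrow> ('x \<times> real \<Rightarrow> real) \<Rightarrow> real" where
  "weight G \<eta> x p y 0 g = 1 / real (card G)"
| "weight G \<eta> x p y (Suc t) g =
     weight G \<eta> x p y t g *
       exp (\<eta> * (y t - p t) * g (x t, p t) - 2 * \<eta>\<^sup>2 * (g (x t, p t))\<^sup>2)"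

definition normalized_weight ::
  "('x \<times> real \<Rightarrow> real) set \<Rightarrow> real \<Rightarrow> (nat \<Rightarrow> 'x) \<Rightarrow> (nat \<Rightarrow> real) \<Rightarrow> (nat \<Rightarrow> real)
    \<Rightarrow> nat \<Rightarrow> ('x \<times> real \<Rightarrow> real) \<Rightarrow> real" where
  "normalized_weight G \<eta> x p y t g =
     weight G \<eta> x p y t g / (\<Sum>g'\<in>G. weight G \<eta> x p y t g')"

definition weighted_test ::
  "('x \<times> real \<Rightarrow> real) set \<Rightarrow> real \<Rightarrow> (nat \<Rightarrow> 'x) \<Rightarrow> (nat \<Rightarrow> real) \<Rightarrow> (nat \<Rightarrow> real)
    \<Rightarrow> nat \<Rightarrow> real \<Rightarrow> real" where
  "weighted_test G \<eta> x p y t \<gamma> = (\<Sum>g\<in>G. normalized_weight G \<eta> x p y t g * g (x t, \<gamma>))"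

definition two_point_pmf :: "real \<Rightarrow> real \<Rightarrow> real \<Rightarrow> real pmf" where
  "two_point_pmf l a b = map_pmf (\<lambda>c. if c then b else a) (bernoulli_pmf l)"

text \<open>
  A relation rather than a function, because the rule leaves open which sign change of \<open>F\<close>
  and which zero endpoint is used.
\<close>

definition approachability_choice :: "nat \<Rightarrow> (real \<Rightarrow> real) \<Rightarrow> real pmf \<Rightarrow> bool" where
  "approachability_choice N F q \<longleftrightarrow>
    (if F 0 \<le> 0 then q = return_pmf 0
     else if F 1 \<ge> 0 then q = return_pmf 1
     else \<exists>a\<in>grid N. \<exists>b\<in>grid N. b = a + 1 / real N \<and> F a \<ge> 0 \<and> 0 \<ge> F b \<and>
       (if F a = 0 \<or> F b = 0 then \<exists>c\<in>{a, b}. F c = 0 \<and> q = return_pmf c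
        else q = two_point_pmf (F a / (F a - F b)) a b))"

definition runs_approachability ::
  "'w measure \<Rightarrow> nat \<Rightarrow> nat \<Rightarrow> ('x \<times> real \<Rightarrow> real) set \<Rightarrow> real \<Rightarrow> (nat \<Rightarrow> 'w \<Rightarrow> 'x)
    \<Rightarrow> (nat \<Rightarrow> 'w \<Rightarrow> real pmf) \<Rightarrow> (nat \<Rightarrow> 'w \<Rightarrow> real) \<Rightarrow> (nat \<Rightarrow> 'w \<Rightarrow> real) \<Rightarrow> bool" where
  "runs_approachability M N T G \<eta> x \<psi> p y \<longleftrightarrow>
    (\<forall>t<T. \<forall>\<omega>\<in>space M. approachability_choice N
       (weighted_test G \<eta> (\<lambda>s. x s \<omega>) (\<lambda>s. p s \<omega>) (\<lambda>s. y s \<omega>) t) (\<psi> t \<omega>))"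

end

theory Submission
  imports Defs
begin

text \<open>
  The total weight is a supermartingale up to a factor \<open>1 + 1 / (4 N\<^sup>2)\<close> per round. Indeed, with
  \<open>s = \<eta> (y - p) g\<close> and \<open>h = \<eta>\<^sup>2 g\<^sup>2 \<ge> s\<^sup>2\<close> one has \<open>exp (s - 2 h) \<le> 1 + s - h / 4\<close>, so that by
  Jensen the conditional expectation of the growth factor is at most
  \<open>1 + E (\<eta> (y - p) F p - \<eta>\<^sup>2 (F p)\<^sup>2 / 4)\<close>. Rounding between two adjacent grid points costs a linear
  term of order \<open>\<eta> A B / (N (A + B))\<close>, where \<open>A = F a\<close> and \<open>B = - F b\<close>; the quadratic term equals
  \<open>- \<eta>\<^sup>2 A B / 4\<close> and absorbs it up to \<open>1 / (4 N\<^sup>2)\<close>. Markov's inequality for the total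
  weight after \<open>T\<close> rounds bounds all individual weights at once.
\<close>

section \<open>Elementary exponential inequalities\<close>

text \<open>Squaring \<open>1 - u / 2 \<le> exp (- (u / 2))\<close> bounds \<open>exp (- u)\<close>
  from below, and the product of that bound with \<open>1 + u + u\<^sup>2\<close> equals
  \<open>1 + u\<^sup>2 * (1 - 3 * u + u\<^sup>2) / 4\<close>. For \<open>u \<le> 1 / 4\<close> this
  is at least 1.\<close>

lemma exp_le_one_plus_plus_square:
  fixes u :: real
  assumes "u \<le> 1 / 4"
  shows "exp u \<le> 1 + u + u\<^sup>2"
proof -
  have pos: "0 < 1 - u / 2" using assms by simp
  have "1 - u / 2 \<le> exp (- (u / 2))"
    using exp_ge_add_one_self[of "- (u / 2)"] by simp
  then have "(1 - u / 2)\<^sup>2 \<le> (exp (- (u / 2)))\<^sup>2"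
    using pos by (intro power_mono) auto
  also have "\<dots> = exp (- u)"
    by (simp add: power2_eq_square flip: exp_add)
  finally have lower: "(1 - u / 2)\<^sup>2 \<le> exp (- u)" .
  have q: "0 \<le> 1 + u + u\<^sup>2"
    using zero_le_power2[of "u + 1 / 2"] by (simp add: power2_eq_square algebra_simps)
  have "0 \<le> u\<^sup>2 * (1 - 3 * u + u\<^sup>2)"
    using assms by (intro mult_nonneg_nonneg add_nonneg_nonneg) auto
  then have "1 \<le> (1 - u / 2)\<^sup>2 * (1 + u + u\<^sup>2)"
    by (simp add: power2_eq_square algebra_simps)
  also have "\<dots> \<le> exp (- u) * (1 + u + u\<^sup>2)"
    using lower q by (rule mult_right_mono)
  finally show ?thesis
    by (simp add: exp_minus field_simps)
qed

text \<open>The factors \<open>exp s\<close> and \<open>exp (- 2 * h)\<close> are expanded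
  separately to second order. Their product exceeds \<open>1 + s - h\<close> only by
  \<open>h\<close> times a bracket that the smallness assumptions keep below 3/4, so a quarter of
  \<open>h\<close> survives as a gain.\<close>

lemma exp_minus_quadratic_le:
  fixes s h :: real
  assumes "s\<^sup>2 \<le> h" "\<bar>s\<bar> \<le> 1 / 4" "h \<le> 1 / 16"
  shows "exp (s - 2 * h) \<le> 1 + s - h / 4"
proof -
  have h0: "0 \<le> h" using assms(1) zero_le_power2[of s] by linarith
  have "exp s \<le> 1 + s + h"
    using exp_le_one_plus_plus_square[of s] assms by linarith
  moreover have "exp (- 2 * h) \<le> 1 - 2 * h + 4 * h\<^sup>2"
    using exp_le_one_plus_plus_square[of "- 2 * h"] h0 by (simp add: power2_eq_square)
  ultimately have "exp s * exp (- 2 * h) \<le> (1 + s + h) * (1 - 2 * h + 4 * h\<^sup>2)"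
    using assms h0 by (intro mult_mono) auto
  also have "\<dots> = 1 + s - h + h * (- 2 * s + 2 * h + 4 * h * s + 4 * (h * h))"
    by (simp add: power2_eq_square algebra_simps)
  also have "\<dots> \<le> 1 + s - h + h * (3 / 4)"
  proof -
    \<comment> \<open>The four terms of the bracket are at most 1/2, 1/8, 1/16 and 1/64.\<close>
    have "h * s \<le> h * (1 / 4)"
      using assms h0 by (intro mult_left_mono) (auto simp: abs_le_iff)
    moreover have "h * h \<le> 1 / 16 * (1 / 16)"
      using assms h0 by (intro mult_mono) auto
    ultimately have "- 2 * s + 2 * h + 4 * h * s + 4 * (h * h) \<le> 3 / 4"
      using assms by (simp add: abs_le_iff)
    then show ?thesis using h0 by (intro add_left_mono mult_left_mono) auto
  qed
  finally show ?thesis by (simp add: exp_diff exp_minus field_simps)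
qed

section \<open>The grid and the drift of one rounding step\<close>

lemma finite_grid [simp]: "finite (grid N)"
proof -
  have "grid N = (\<lambda>k. real k / real N) ` {..N}" by (auto simp: grid_def)
  then show ?thesis by simp
qed

lemma grid_bounds: "\<gamma> \<in> grid N \<Longrightarrow> 0 \<le> \<gamma> \<and> \<gamma> \<le> 1"
  by (auto simp: grid_def divide_le_eq_1)

text \<open>Here \<open>k\<close> stands for the grid spacing. For
  \<open>m = A * B / (A + B)\<close> the arithmetic-geometric mean inequality gives
  \<open>m\<^sup>2 \<le> A * B / 4\<close>, so the quadratic gain covers
  \<open>\<eta>\<^sup>2 * m\<^sup>2\<close>. Completing the square in
  \<open>\<eta> * m - k / 2\<close> then leaves only \<open>k\<^sup>2 / 4\<close>.\<close>

lemma two_point_drift: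
  fixes A B :: real
  assumes "0 < A" "0 < B"
  shows "\<eta> * (A * B / (A + B)) * k - \<eta>\<^sup>2 / 4 * (A * B) \<le> k\<^sup>2 / 4"
proof -
  define m where "m = A * B / (A + B)"
  have "4 * (A * B) \<le> (A + B)\<^sup>2"
    using zero_le_power2[of "A - B"] by (simp add: power2_eq_square algebra_simps)
  then have "A * B * (4 * (A * B)) \<le> A * B * (A + B)\<^sup>2"
    using assms by (intro mult_left_mono) auto
  then have "m\<^sup>2 \<le> A * B / 4"
    using assms by (simp add: m_def power_divide divide_simps power2_eq_square)
  then have "\<eta>\<^sup>2 * m\<^sup>2 \<le> \<eta>\<^sup>2 * (A * B / 4)" by (intro mult_left_mono) auto
  then have "\<eta>\<^sup>2 * m\<^sup>2 \<le> \<eta>\<^sup>2 / 4 * (A * B)" by simp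
  moreover have "\<eta> * m * k \<le> \<eta>\<^sup>2 * m\<^sup>2 + k\<^sup>2 / 4"
    using zero_le_power2[of "\<eta> * m - k / 2"] by (simp add: power2_eq_square algebra_simps)
  ultimately show ?thesis unfolding m_def[symmetric] by linarith
qed

text \<open>A point mass is chosen only where \<open>(v - c) * F c \<le> 0\<close> for both
  outcomes: at 0 with \<open>F 0 \<le> 0\<close>, at 1 with \<open>F 1 \<ge> 0\<close>, or at a zero
  of \<open>F\<close>. Only a genuine mixture has positive linear drift, and there the squared term
  compensates.\<close>

lemma approachability_drift:
  assumes choice: "approachability_choice N F q" and N: "N \<ge> 1"
    and v: "v \<in> {0, 1}" and \<eta>: "0 \<le> \<eta>"
  shows "measure_pmf.expectation q (\<lambda>\<gamma>. \<eta> * (v - \<gamma>) * F \<gamma> - \<eta>\<^sup>2 / 4 * (F \<gamma>)\<^sup>2) \<le> 1 / (4 * (real N)\<^sup>2)"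
    (is "measure_pmf.expectation q ?f \<le> _")
proof -
  have rhs: "0 \<le> 1 / (4 * (real N)\<^sup>2)" by simp
  have sq: "0 \<le> \<eta>\<^sup>2 / 4 * (F c)\<^sup>2" for c by simp
  have point: ?thesis if "q = return_pmf c" "(v - c) * F c \<le> 0" for c
  proof -
    have "\<eta> * ((v - c) * F c) \<le> 0" using \<eta> that(2) by (rule mult_nonneg_nonpos)
    then have "?f c \<le> 0" using sq[of c] unfolding mult.assoc by linarith
    then have "?f c \<le> 1 / (4 * (real N)\<^sup>2)" using rhs by linarith
    then show ?thesis using that(1) by simp
  qed
  consider (low) "F 0 \<le> 0" "q = return_pmf 0"
    | (high) "F 1 \<ge> 0" "q = return_pmf 1"
    | (zero) c where "F c = 0" "q = return_pmf c"
    | (mixed) a b where "b = a + 1 / real N" "F a > 0" "F b < 0"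
        "q = two_point_pmf (F a / (F a - F b)) a b"
    using choice unfolding approachability_choice_def
    by (smt (verit) insert_iff singletonD)
  then show ?thesis
  proof cases
    case low
    then show ?thesis using v by (intro point[of 0]) auto
  next
    case high
    then show ?thesis using v by (intro point[of 1]) auto
  next
    case zero
    then show ?thesis by (intro point[of c]) auto
  next
    case mixed
    define A B where "A = F a" and "B = - F b"
    have AB: "0 < A" "0 < B" using mixed by (auto simp: A_def B_def)
    define l where "l = A / (A + B)"
    have l: "0 \<le> l" "l \<le> 1" using AB by (auto simp: l_def)
    have Fb: "F b = - B" and Fa: "F a = A" by (auto simp: A_def B_def)
    have q: "q = two_point_pmf l a b" using mixed(4) unfolding l_def Fa Fb by simp
    have "measure_pmf.expectation q ?f = ?f b * l + ?f a * (1 - l)"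
      using l by (simp add: q two_point_pmf_def)
    also have "\<dots> = \<eta> * (A * B / (A + B)) * (1 / real N) - \<eta>\<^sup>2 / 4 * (A * B)"
    proof -
      \<comment> \<open>The masses are \<open>B / (A + B)\<close> at \<open>a\<close> and
        \<open>A / (A + B)\<close> at \<open>b\<close>, so \<open>F\<close> has mean 0. The outcome
        \<open>v\<close> therefore cancels from the linear term and only the gap
        \<open>b - a\<close> remains, while the mean of the square of \<open>F\<close> is
        \<open>A * B\<close>.\<close>
      have l1: "1 - l = B / (A + B)" using AB by (simp add: l_def field_simps)
      have "?f b * l + ?f a * (1 - l) = (?f b * A + ?f a * B) / (A + B)"
        unfolding l1 unfolding l_def by (simp add: add_divide_distrib)
      also have "?f b * A + ?f a * B
        = \<eta> * (b - a) * (A * B) - \<eta>\<^sup>2 / 4 * (A * B * (A + B))"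
        unfolding Fa Fb by algebra
      also have "\<dots> / (A + B) = \<eta> * (A * B / (A + B)) * (b - a) - \<eta>\<^sup>2 / 4 * (A * B)"
        using AB by (simp add: field_simps)
      finally show ?thesis using mixed(1) by simp
    qed
    also have "\<dots> \<le> (1 / real N)\<^sup>2 / 4"
      using AB by (rule two_point_drift)
    finally show ?thesis by (simp add: power_divide)
  qed
qed

section \<open>The weight process and its pointwise bounds\<close>

locale approachability_run = online_protocol M H X N T x \<psi> p y
  for M :: "'w measure" and H and X :: "'x measure" and N T x \<psi> p y +
  fixes G :: "('x \<times> real \<Rightarrow> real) set" and \<eta> :: real
  assumes N_pos: "N \<ge> 1"
    and finite_G: "finite G" and G_nonempty: "G \<noteq> {}"
    and G_range: "G \<subseteq> (space X \<times> grid N) \<rightarrow>\<^sub>E {-1..1}"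
    and G_measurable: "\<And>g \<gamma>. g \<in> G \<Longrightarrow> \<gamma> \<in> grid N \<Longrightarrow> (\<lambda>\<xi>. g (\<xi>, \<gamma>)) \<in> borel_measurable X"
    and \<eta>_pos: "0 < \<eta>" and \<eta>_le: "\<eta> \<le> 1 / 4"
    and runs: "runs_approachability M N T G \<eta> x \<psi> p y"
begin

definition W :: "nat \<Rightarrow> ('x \<times> real \<Rightarrow> real) \<Rightarrow> 'w \<Rightarrow> real" where
  "W t g \<omega> = weight G \<eta> (\<lambda>s. x s \<omega>) (\<lambda>s. p s \<omega>) (\<lambda>s. y s \<omega>) t g"

text \<open>The prediction is a free argument instead of the draw \<open>p t\<close>: at a fixed
  \<open>\<gamma>\<close> the factor is already determined by the information in
  \<open>H t\<close>.\<close>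

definition growth :: "nat \<Rightarrow> ('x \<times> real \<Rightarrow> real) \<Rightarrow> 'w \<Rightarrow> real \<Rightarrow> real" where
  "growth t g \<omega> \<gamma> = exp (\<eta> * (y t \<omega> - \<gamma>) * g (x t \<omega>, \<gamma>) - 2 * \<eta>\<^sup>2 * (g (x t \<omega>, \<gamma>))\<^sup>2)"

lemma W_0: "W 0 g \<omega> = 1 / real (card G)"
  by (simp add: W_def)

lemma W_Suc: "W (Suc t) g \<omega> = W t g \<omega> * growth t g \<omega> (p t \<omega>)"
  by (simp add: W_def growth_def)

lemma W_pos: "0 < W t g \<omega>"
  using finite_G G_nonempty by (induction t) (auto simp: W_0 W_Suc growth_def card_gt_0_iff)

text \<open>The exponents of the multiplicative updates add up to the bias and the mass, which ties
  a bound on the weights to the claimed bound on the bias.\<close>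

lemma W_eq_exp:
  "W t g \<omega> = exp (\<eta> * Bias t (\<lambda>s. x s \<omega>) (\<lambda>s. p s \<omega>) (\<lambda>s. y s \<omega>) g
      - 2 * \<eta>\<^sup>2 * Mass t (\<lambda>s. x s \<omega>) (\<lambda>s. p s \<omega>) g) / real (card G)"
proof (induction t)
  case 0
  then show ?case by (simp add: W_0 Bias_def Mass_def)
next
  case (Suc t)
  then show ?case
    by (simp add: W_Suc growth_def Bias_def Mass_def algebra_simps flip: exp_add)
qed

lemma space_H: "t \<le> T \<Longrightarrow> space (H t) = space M"
  using subalgebra_H by (auto simp: subalgebra_def)

lemma measurable_from_H: "t \<le> T \<Longrightarrow> f \<in> measurable (H t) K \<Longrightarrow> f \<in> measurable M K"
  using subalgebra_H measurable_from_subalg by blast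

lemma outcome_values: "t < T \<Longrightarrow> \<omega> \<in> space M \<Longrightarrow> y t \<omega> \<in> {0, 1}"
  using measurable_space[OF outcome_measurable, of t \<omega>] space_H[of t] by simp

lemma draw_values: "t < T \<Longrightarrow> \<omega> \<in> space M \<Longrightarrow> p t \<omega> \<in> grid N"
  using measurable_space[OF draw_measurable, of t \<omega>] space_H[of "Suc t"] by simp

lemma test_bounded:
  assumes "t < T" "\<omega> \<in> space M" "g \<in> G" "\<gamma> \<in> grid N"
  shows "\<bar>g (x t \<omega>, \<gamma>)\<bar> \<le> 1"
proof -
  have "x t \<omega> \<in> space X"
    using measurable_space[OF context_measurable, of t \<omega>] space_H[of t] assms by simp
  then have "g (x t \<omega>, \<gamma>) \<in> {-1..1}" using G_range assms by (auto simp: PiE_iff)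
  then show ?thesis by (simp add: abs_le_iff)
qed

text \<open>The inequality \<open>exp_minus_quadratic_le\<close> applies with
  \<open>s = \<eta> * v * c\<close> and \<open>h = \<eta>\<^sup>2 * c\<^sup>2\<close>:
  \<open>\<bar>v\<bar> \<le> 1\<close> gives \<open>s\<^sup>2 \<le> h\<close>, and
  \<open>\<eta> \<le> 1 / 4\<close> with \<open>\<bar>c\<bar> \<le> 1\<close> gives the two
  smallness conditions.\<close>

lemma growth_le:
  assumes t: "t < T" and \<omega>: "\<omega> \<in> space M" and g: "g \<in> G" and \<gamma>: "\<gamma> \<in> grid N"
  shows "growth t g \<omega> \<gamma>
    \<le> 1 + \<eta> * (y t \<omega> - \<gamma>) * g (x t \<omega>, \<gamma>) - \<eta>\<^sup>2 / 4 * (g (x t \<omega>, \<gamma>))\<^sup>2"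
proof -
  define c where "c = g (x t \<omega>, \<gamma>)"
  define v where "v = y t \<omega> - \<gamma>"
  have c: "\<bar>c\<bar> \<le> 1" unfolding c_def by (rule test_bounded[OF t \<omega> g \<gamma>])
  have v: "\<bar>v\<bar> \<le> 1"
    using outcome_values[OF t \<omega>] grid_bounds[OF \<gamma>] by (auto simp: v_def)
  have c2: "c\<^sup>2 \<le> 1" and v2: "v\<^sup>2 \<le> 1" using c v by (auto simp: abs_square_le_1)
  have \<eta>2: "\<eta>\<^sup>2 \<le> 1 / 16"
    using power_mono[OF \<eta>_le, of 2] \<eta>_pos by (simp add: power2_eq_square)
  have "exp (\<eta> * v * c - 2 * (\<eta>\<^sup>2 * c\<^sup>2)) \<le> 1 + \<eta> * v * c - \<eta>\<^sup>2 * c\<^sup>2 / 4"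
  proof (rule exp_minus_quadratic_le)
    have "(\<eta>\<^sup>2 * c\<^sup>2) * v\<^sup>2 \<le> (\<eta>\<^sup>2 * c\<^sup>2) * 1" using v2 by (intro mult_left_mono) auto
    then show "(\<eta> * v * c)\<^sup>2 \<le> \<eta>\<^sup>2 * c\<^sup>2" by (simp add: power_mult_distrib algebra_simps)
    have "\<bar>\<eta>\<bar> * \<bar>v\<bar> * \<bar>c\<bar> \<le> 1 / 4 * 1 * 1"
      using c v \<eta>_pos \<eta>_le by (intro mult_mono) auto
    then show "\<bar>\<eta> * v * c\<bar> \<le> 1 / 4" by (simp add: abs_mult)
    show "\<eta>\<^sup>2 * c\<^sup>2 \<le> 1 / 16" using mult_mono[OF \<eta>2 c2] by simp
  qed
  then show ?thesis by (simp add: growth_def c_def v_def mult.assoc)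
qed

lemma growth_le_2:
  assumes "t < T" "\<omega> \<in> space M" "g \<in> G" "\<gamma> \<in> grid N"
  shows "growth t g \<omega> \<gamma> \<le> 2"
proof -
  have v: "\<bar>y t \<omega> - \<gamma>\<bar> \<le> 1"
    using outcome_values[OF assms(1,2)] grid_bounds[OF assms(4)] by auto
  have "\<bar>\<eta>\<bar> * \<bar>y t \<omega> - \<gamma>\<bar> * \<bar>g (x t \<omega>, \<gamma>)\<bar> \<le> 1 / 4 * 1 * 1"
    using v test_bounded[OF assms] \<eta>_pos \<eta>_le by (intro mult_mono) auto
  then have "\<eta> * (y t \<omega> - \<gamma>) * g (x t \<omega>, \<gamma>) \<le> 1"
    by (simp add: abs_le_iff flip: abs_mult)
  moreover have "0 \<le> \<eta>\<^sup>2 / 4 * (g (x t \<omega>, \<gamma>))\<^sup>2" by simp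
  ultimately show ?thesis using growth_le[OF assms] by linarith
qed

text \<open>Each round at most doubles a weight that starts at or below 1. This crude deterministic
  bound serves only to make all integrals finite.\<close>

lemma W_bounded:
  assumes "t \<le> T" "\<omega> \<in> space M" "g \<in> G"
  shows "W t g \<omega> \<le> 2 ^ t"
  using assms
proof (induction t)
  case 0
  have "1 \<le> card G" using finite_G G_nonempty by (simp add: Suc_le_eq card_gt_0_iff)
  then show ?case by (simp add: W_0)
next
  case (Suc t)
  have "W t g \<omega> * growth t g \<omega> (p t \<omega>) \<le> 2 ^ t * 2"
    using Suc W_pos[of t g \<omega>] draw_values[of t \<omega>]
    by (intro mult_mono growth_le_2) (auto simp: growth_def)
  then show ?case by (simp add: W_Suc)
qed

section \<open>Measurability and integrability of the weights\<close>

lemma growth_measurable: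
  assumes "t < T" "g \<in> G" "\<gamma> \<in> grid N"
  shows "(\<lambda>\<omega>. growth t g \<omega> \<gamma>) \<in> borel_measurable (H t)"
proof -
  have [measurable]: "y t \<in> borel_measurable (H t)"
    using outcome_measurable[OF assms(1)] by (rule measurable_compose) simp
  have [measurable]: "(\<lambda>\<omega>. g (x t \<omega>, \<gamma>)) \<in> borel_measurable (H t)"
    using context_measurable[OF assms(1)] G_measurable[OF assms(2,3)] by (rule measurable_compose)
  show ?thesis unfolding growth_def by measurable
qed

text \<open>The weight of round \<open>t\<close> involves only draws of earlier rounds, and
  \<open>p s\<close> is known from \<open>H (Suc s)\<close> on. Hence the weight is fixed before the
  draw \<open>p t\<close>.\<close>

lemma W_measurable:
  assumes "t \<le> T" "g \<in> G"
  shows "W t g \<in> borel_measurable (H t)"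
  using assms
proof (induction t)
  case 0
  then show ?case by (simp add: W_0[abs_def])
next
  case (Suc t)
  then have t: "t < T" by simp
  have sub: "subalgebra (H (Suc t)) (H t)" using mono_H[of t "Suc t"] Suc by simp
  have [measurable]: "W t g \<in> borel_measurable (H (Suc t))"
    using Suc by (intro measurable_from_subalg[OF sub]) auto
  have [measurable]: "(\<lambda>\<omega>. growth t g \<omega> (p t \<omega>)) \<in> borel_measurable (H (Suc t))"
  \<comment> \<open>The draw takes finitely many values, so measurability at each fixed grid point
    suffices for evaluation at the draw.\<close>
  proof (rule measurable_compose_countable'[where I = "grid N" and f = "\<lambda>\<gamma> \<omega>. growth t g \<omega> \<gamma>"])
    show "(\<lambda>\<omega>. growth t g \<omega> \<gamma>) \<in> borel_measurable (H (Suc t))" if "\<gamma> \<in> grid N" for \<gamma>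
      using growth_measurable[OF t Suc.prems(2) that] by (rule measurable_from_subalg[OF sub])
  qed (use draw_measurable[OF t] in \<open>auto intro: countable_finite\<close>)
  show ?case unfolding W_Suc[abs_def] by measurable
qed

lemma W_measurable_M: "t \<le> T \<Longrightarrow> g \<in> G \<Longrightarrow> W t g \<in> borel_measurable M"
  using W_measurable measurable_from_H by blast

lemma W_integrable:
  assumes "t \<le> T" "g \<in> G"
  shows "integrable M (W t g)"
  using W_bounded[OF assms(1) _ assms(2)] less_imp_le[OF W_pos] W_measurable_M[OF assms]
  by (intro integrable_const_bound[of _ "2 ^ t"]) (auto intro!: AE_I2)

section \<open>Integrating out the fresh draw\<close>

text \<open>Nonanticipation enters here: \<open>f\<close> is \<open>H t\<close>-measurable because
  the outcome is, so conditioning on \<open>H t\<close> replaces the event that the draw equals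
  \<open>\<gamma>\<close> by its announced probability.\<close>

lemma integral_draw_eq:
  assumes t: "t < T" and g: "g \<in> G" and \<gamma>: "\<gamma> \<in> grid N"
  defines "f \<equiv> \<lambda>\<omega>. W t g \<omega> * growth t g \<omega> \<gamma>"
  shows "integrable M (\<lambda>\<omega>. f \<omega> * indicat_real {\<omega>' \<in> space M. p t \<omega>' = \<gamma>} \<omega>)"
    and "integrable M (\<lambda>\<omega>. f \<omega> * pmf (\<psi> t \<omega>) \<gamma>)"
    and "(\<integral>\<omega>. f \<omega> * indicat_real {\<omega>' \<in> space M. p t \<omega>' = \<gamma>} \<omega> \<partial>M) = (\<integral>\<omega>. f \<omega> * pmf (\<psi> t \<omega>) \<gamma> \<partial>M)"
proof -
  let ?I = "indicat_real {\<omega>' \<in> space M. p t \<omega>' = \<gamma>}"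
  interpret S: finite_measure_subalgebra M "H t"
    using t subalgebra_H by unfold_locales auto
  have fH: "f \<in> borel_measurable (H t)"
    unfolding f_def using W_measurable[of t g] growth_measurable[OF t g \<gamma>] t g by simp
  have [measurable]: "f \<in> borel_measurable M" using measurable_from_H[OF _ fH] t by simp
  have [measurable]: "p t \<in> measurable M (count_space (grid N))"
    using measurable_from_H[OF _ draw_measurable[OF t]] t by simp
  have [measurable]: "?I \<in> borel_measurable M"
  proof (rule borel_measurable_indicator)
    have "p t -` {\<gamma>} \<inter> space M \<in> sets M" using \<gamma> by (intro measurable_sets[where A="count_space (grid N)"]) auto
    then show "{\<omega>' \<in> space M. p t \<omega>' = \<gamma>} \<in> sets M"
      by (simp add: vimage_def Int_def conj_commute)
  qed
  have [measurable]: "(\<lambda>\<omega>. pmf (\<psi> t \<omega>) \<gamma>) \<in> borel_measurable M"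
    using measurable_from_H[OF _ announced_measurable[OF t]] t by simp
  have f_bound: "\<bar>f \<omega>\<bar> \<le> 2 ^ Suc t" if "\<omega> \<in> space M" for \<omega>
  proof -
    have "W t g \<omega> * growth t g \<omega> \<gamma> \<le> 2 ^ t * 2"
      using W_bounded[of t \<omega> g] growth_le_2[OF t that g \<gamma>] t that g
      by (intro mult_mono) (auto simp: growth_def)
    moreover have "0 \<le> f \<omega>" using W_pos[of t g \<omega>] by (simp add: f_def growth_def)
    ultimately show ?thesis by (simp add: f_def)
  qed
  \<comment> \<open>Taken for a general multiplier bounded by 1, this covers both the indicator and
    the announced probability.\<close>
  have bounded: "integrable M (\<lambda>\<omega>. f \<omega> * u \<omega>)"
    if [measurable]: "u \<in> borel_measurable M" and "\<And>\<omega>. \<bar>u \<omega>\<bar> \<le> 1" for u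
  proof (rule integrable_const_bound[of _ "2 ^ Suc t"])
    show "AE \<omega> in M. norm (f \<omega> * u \<omega>) \<le> 2 ^ Suc t"
    proof (rule AE_I2)
      fix \<omega> assume "\<omega> \<in> space M"
      then have "\<bar>f \<omega>\<bar> * \<bar>u \<omega>\<bar> \<le> 2 ^ Suc t * 1"
        using f_bound that(2) by (intro mult_mono) auto
      then show "norm (f \<omega> * u \<omega>) \<le> 2 ^ Suc t" by (simp add: abs_mult)
    qed
  qed simp
  show int: "integrable M (\<lambda>\<omega>. f \<omega> * ?I \<omega>)"
    by (rule bounded) (auto simp: indicator_def)
  show "integrable M (\<lambda>\<omega>. f \<omega> * pmf (\<psi> t \<omega>) \<gamma>)"
    by (rule bounded) (auto simp: pmf_le_1)
  have "(\<integral>\<omega>. f \<omega> * ?I \<omega> \<partial>M) = (\<integral>\<omega>. f \<omega> * real_cond_exp M (H t) ?I \<omega> \<partial>M)"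
    using S.real_cond_exp_intg(2)[OF int fH] by simp
  also have "\<dots> = (\<integral>\<omega>. f \<omega> * pmf (\<psi> t \<omega>) \<gamma> \<partial>M)"
    using fresh_draw[OF t \<gamma>] by (intro integral_cong_AE) auto
  finally show "(\<integral>\<omega>. f \<omega> * ?I \<omega> \<partial>M) = (\<integral>\<omega>. f \<omega> * pmf (\<psi> t \<omega>) \<gamma> \<partial>M)" .
qed

section \<open>Growth of the expected total weight\<close>

text \<open>The left side is the total weight after the round, averaged over the announced
  distribution with everything else frozen. Normalizing the weights turns the average of the linear
  terms into \<open>F\<close>, and the square of \<open>F\<close> bounds the averaged squares from
  below, which reduces the claim to \<open>approachability_drift\<close>.\<close>

lemma expected_growth_le:
  assumes t: "t < T" and \<omega>: "\<omega> \<in> space M"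
  shows "(\<Sum>g\<in>G. \<Sum>\<gamma>\<in>grid N. W t g \<omega> * growth t g \<omega> \<gamma> * pmf (\<psi> t \<omega>) \<gamma>)
    \<le> (1 + 1 / (4 * (real N)\<^sup>2)) * (\<Sum>g\<in>G. W t g \<omega>)"
proof -
  define S where "S = (\<Sum>g\<in>G. W t g \<omega>)"
  define w where "w = (\<lambda>g. W t g \<omega> / S)"
  define F where "F = weighted_test G \<eta> (\<lambda>s. x s \<omega>) (\<lambda>s. p s \<omega>) (\<lambda>s. y s \<omega>) t"
  have S: "0 < S" unfolding S_def using finite_G G_nonempty W_pos by (intro sum_pos) auto
  have W_w: "W t g \<omega> = S * w g" for g using S by (simp add: w_def)
  have w_nonneg: "0 \<le> w g" for g using S W_pos[of t g \<omega>] by (simp add: w_def)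
  have w_sum: "(\<Sum>g\<in>G. w g) = 1"
    using S by (simp add: w_def S_def flip: sum_divide_distrib)
  have F_eq: "F \<gamma> = (\<Sum>g\<in>G. w g * g (x t \<omega>, \<gamma>))" for \<gamma>
    by (simp add: F_def weighted_test_def normalized_weight_def w_def S_def W_def)
  have jensen: "(F \<gamma>)\<^sup>2 \<le> (\<Sum>g\<in>G. w g * (g (x t \<omega>, \<gamma>))\<^sup>2)" for \<gamma>
  proof -
    \<comment> \<open>This is the variance of the tests under the normalized weights, whose mean is
      \<open>F \<gamma>\<close>.\<close>
    have "0 \<le> (\<Sum>g\<in>G. w g * (g (x t \<omega>, \<gamma>) - F \<gamma>)\<^sup>2)"
      by (intro sum_nonneg mult_nonneg_nonneg w_nonneg) auto
    also have "\<dots> = (\<Sum>g\<in>G. w g * (g (x t \<omega>, \<gamma>))\<^sup>2 - 2 * F \<gamma> * (w g * g (x t \<omega>, \<gamma>)) + (F \<gamma>)\<^sup>2 * w g)"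
      by (intro sum.cong) (auto simp: power2_eq_square algebra_simps)
    also have "\<dots> = (\<Sum>g\<in>G. w g * (g (x t \<omega>, \<gamma>))\<^sup>2) - (F \<gamma>)\<^sup>2"
      by (simp add: sum.distrib sum_subtractf w_sum power2_eq_square flip: sum_distrib_left F_eq)
    finally show ?thesis by simp
  qed
  let ?f = "\<lambda>\<gamma>. \<eta> * (y t \<omega> - \<gamma>) * F \<gamma> - \<eta>\<^sup>2 / 4 * (F \<gamma>)\<^sup>2"
  have avg: "(\<Sum>g\<in>G. w g * growth t g \<omega> \<gamma>) \<le> 1 + ?f \<gamma>" if "\<gamma> \<in> grid N" for \<gamma>
  proof -
    have "(\<Sum>g\<in>G. w g * growth t g \<omega> \<gamma>)
      \<le> (\<Sum>g\<in>G. w g * (1 + \<eta> * (y t \<omega> - \<gamma>) * g (x t \<omega>, \<gamma>) - \<eta>\<^sup>2 / 4 * (g (x t \<omega>, \<gamma>))\<^sup>2))"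
      by (intro sum_mono mult_left_mono growth_le t \<omega> that w_nonneg)
    also have "\<dots> = (\<Sum>g\<in>G. w g + \<eta> * (y t \<omega> - \<gamma>) * (w g * g (x t \<omega>, \<gamma>))
        - \<eta>\<^sup>2 / 4 * (w g * (g (x t \<omega>, \<gamma>))\<^sup>2))"
      by (intro sum.cong) (auto simp: algebra_simps)
    also have "\<dots> = 1 + \<eta> * (y t \<omega> - \<gamma>) * F \<gamma> - \<eta>\<^sup>2 / 4 * (\<Sum>g\<in>G. w g * (g (x t \<omega>, \<gamma>))\<^sup>2)"
      by (simp only: sum.distrib sum_subtractf w_sum sum_distrib_left[symmetric] F_eq)
    also have "\<dots> \<le> 1 + ?f \<gamma>"
      using mult_left_mono[OF jensen, of "\<eta>\<^sup>2 / 4" \<gamma>] by simp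
    finally show ?thesis .
  qed
  have supp: "set_pmf (\<psi> t \<omega>) \<subseteq> grid N" using announced_support[OF t \<omega>] .
  have drift: "(\<Sum>\<gamma>\<in>grid N. ?f \<gamma> * pmf (\<psi> t \<omega>) \<gamma>) \<le> 1 / (4 * (real N)\<^sup>2)"
  proof -
    have "approachability_choice N F (\<psi> t \<omega>)"
      using runs t \<omega> by (simp add: runs_approachability_def F_def)
    then have "measure_pmf.expectation (\<psi> t \<omega>) ?f \<le> 1 / (4 * (real N)\<^sup>2)"
      by (rule approachability_drift[OF _ N_pos outcome_values[OF t \<omega>] less_imp_le[OF \<eta>_pos]])
    then show ?thesis using supp by (subst (asm) integral_measure_pmf_real[of "grid N"]) auto
  qed
  have "(\<Sum>g\<in>G. \<Sum>\<gamma>\<in>grid N. W t g \<omega> * growth t g \<omega> \<gamma> * pmf (\<psi> t \<omega>) \<gamma>)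
    = S * (\<Sum>\<gamma>\<in>grid N. (\<Sum>g\<in>G. w g * growth t g \<omega> \<gamma>) * pmf (\<psi> t \<omega>) \<gamma>)"
    by (subst sum.swap) (simp add: W_w sum_distrib_left sum_distrib_right mult.assoc)
  also have "\<dots> \<le> S * (\<Sum>\<gamma>\<in>grid N. (1 + ?f \<gamma>) * pmf (\<psi> t \<omega>) \<gamma>)"
    using S avg by (intro mult_left_mono sum_mono mult_right_mono) auto
  also have "(\<Sum>\<gamma>\<in>grid N. (1 + ?f \<gamma>) * pmf (\<psi> t \<omega>) \<gamma>) = 1 + (\<Sum>\<gamma>\<in>grid N. ?f \<gamma> * pmf (\<psi> t \<omega>) \<gamma>)"
    using supp by (simp only: distrib_right mult_1_left sum.distrib sum_pmf_eq_1 finite_grid)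
  also have "S * \<dots> \<le> S * (1 + 1 / (4 * (real N)\<^sup>2))"
    using S drift by (intro mult_left_mono) auto
  finally show ?thesis by (simp add: S_def mult.commute)
qed

lemma expected_total_weight_Suc:
  assumes t: "t < T"
  shows "(\<integral>\<omega>. (\<Sum>g\<in>G. W (Suc t) g \<omega>) \<partial>M)
    \<le> (1 + 1 / (4 * (real N)\<^sup>2)) * (\<integral>\<omega>. (\<Sum>g\<in>G. W t g \<omega>) \<partial>M)"
proof -
  let ?I = "\<lambda>\<gamma>. indicat_real {\<omega>' \<in> space M. p t \<omega>' = \<gamma>}"
  \<comment> \<open>Splitting by the value of the draw turns the evaluation at a random point into
    finitely many terms with fixed \<open>\<gamma>\<close>, to which \<open>integral_draw_eq\<close>
    applies one by one.\<close>
  have split: "W (Suc t) g \<omega> = (\<Sum>\<gamma>\<in>grid N. W t g \<omega> * growth t g \<omega> \<gamma> * ?I \<gamma> \<omega>)"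
    if "\<omega> \<in> space M" for g \<omega>
    using draw_values[OF t that] that by (simp add: W_Suc indicator_def if_distrib cong: if_cong)
  have "(\<integral>\<omega>. (\<Sum>g\<in>G. W (Suc t) g \<omega>) \<partial>M)
    = (\<integral>\<omega>. (\<Sum>g\<in>G. \<Sum>\<gamma>\<in>grid N. W t g \<omega> * growth t g \<omega> \<gamma> * ?I \<gamma> \<omega>) \<partial>M)"
    by (intro Bochner_Integration.integral_cong) (auto simp: split)
  also have "\<dots> = (\<Sum>g\<in>G. \<Sum>\<gamma>\<in>grid N. \<integral>\<omega>. W t g \<omega> * growth t g \<omega> \<gamma> * ?I \<gamma> \<omega> \<partial>M)"
    using integral_draw_eq(1)[OF t]
    by (simp add: Bochner_Integration.integral_sum Bochner_Integration.integrable_sum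
        del: sum_mult_indicator cong: sum.cong)
  also have "\<dots> = (\<Sum>g\<in>G. \<Sum>\<gamma>\<in>grid N. \<integral>\<omega>. W t g \<omega> * growth t g \<omega> \<gamma> * pmf (\<psi> t \<omega>) \<gamma> \<partial>M)"
    using integral_draw_eq(3)[OF t] by simp
  also have "\<dots> = (\<integral>\<omega>. (\<Sum>g\<in>G. \<Sum>\<gamma>\<in>grid N. W t g \<omega> * growth t g \<omega> \<gamma> * pmf (\<psi> t \<omega>) \<gamma>) \<partial>M)"
    using integral_draw_eq(2)[OF t]
    by (simp add: Bochner_Integration.integral_sum Bochner_Integration.integrable_sum
        del: sum_mult_indicator cong: sum.cong)
  also have "\<dots> \<le> (\<integral>\<omega>. (1 + 1 / (4 * (real N)\<^sup>2)) * (\<Sum>g\<in>G. W t g \<omega>) \<partial>M)"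
    using t by (intro integral_mono expected_growth_le Bochner_Integration.integrable_sum
        integrable_mult_right W_integrable integral_draw_eq(2)) auto
  finally show ?thesis by simp
qed

lemma expected_total_weight:
  "t \<le> T \<Longrightarrow> (\<integral>\<omega>. (\<Sum>g\<in>G. W t g \<omega>) \<partial>M) \<le> exp (2 * real t / (real N)\<^sup>2)"
proof (induction t)
  case 0
  then show ?case using finite_G G_nonempty by (simp add: W_0 prob_space)
next
  case (Suc t)
  \<comment> \<open>The growth rate is relaxed to \<open>2 / (real N)\<^sup>2\<close> to match the
    constant in the claimed bound.\<close>
  have "1 + 1 / (4 * (real N)\<^sup>2) \<le> 1 + 2 / (real N)\<^sup>2"
    using N_pos by (simp add: field_simps)
  also have "\<dots> \<le> exp (2 / (real N)\<^sup>2)"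
    by (rule exp_ge_add_one_self)
  finally have factor: "1 + 1 / (4 * (real N)\<^sup>2) \<le> exp (2 / (real N)\<^sup>2)" .
  have "(\<integral>\<omega>. (\<Sum>g\<in>G. W (Suc t) g \<omega>) \<partial>M)
    \<le> (1 + 1 / (4 * (real N)\<^sup>2)) * (\<integral>\<omega>. (\<Sum>g\<in>G. W t g \<omega>) \<partial>M)"
    using Suc.prems by (intro expected_total_weight_Suc) simp
  also have "\<dots> \<le> exp (2 / (real N)\<^sup>2) * exp (2 * real t / (real N)\<^sup>2)"
    using factor Suc
    by (intro mult_mono Bochner_Integration.integral_nonneg sum_nonneg less_imp_le[OF W_pos]) auto
  also have "\<dots> = exp (2 * real (Suc t) / (real N)\<^sup>2)"
    by (simp add: add_divide_distrib algebra_simps flip: exp_add)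
  finally show ?case .
qed

section \<open>From the expected total weight to the probability bound\<close>

text \<open>Multiply by \<open>\<eta>\<close> and exponentiate; the factor \<open>card G\<close>
  inside the logarithm cancels the initial weight \<open>1 / card G\<close>. As an equivalence it
  identifies the two events exactly.\<close>

lemma bias_bound_iff:
  assumes "0 < \<delta>"
  shows "Bias T (\<lambda>t. x t \<omega>) (\<lambda>t. p t \<omega>) (\<lambda>t. y t \<omega>) g
      \<le> 2 * \<eta> * Mass T (\<lambda>t. x t \<omega>) (\<lambda>t. p t \<omega>) g
        + (ln (real (card G) / \<delta>) + 2 * real T / (real N)\<^sup>2) / \<eta>
    \<longleftrightarrow> W T g \<omega> \<le> exp (2 * real T / (real N)\<^sup>2) / \<delta>"
    (is "?B \<le> 2 * \<eta> * ?Q + (ln _ + ?e) / \<eta> \<longleftrightarrow> _")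
proof -
  have card: "0 < real (card G)" using finite_G G_nonempty by (simp add: card_gt_0_iff)
  have "?B \<le> 2 * \<eta> * ?Q + (ln (real (card G) / \<delta>) + ?e) / \<eta>
    \<longleftrightarrow> \<eta> * ?B - 2 * \<eta>\<^sup>2 * ?Q \<le> ln (real (card G) / \<delta>) + ?e"
    using \<eta>_pos by (simp add: field_simps power2_eq_square)
  also have "\<dots> \<longleftrightarrow> exp (\<eta> * ?B - 2 * \<eta>\<^sup>2 * ?Q) \<le> exp (ln (real (card G) / \<delta>) + ?e)"
    by simp
  also have "exp (ln (real (card G) / \<delta>) + ?e) = real (card G) / \<delta> * exp ?e"
    using card assms by (simp add: exp_add)
  also have "exp (\<eta> * ?B - 2 * \<eta>\<^sup>2 * ?Q) \<le> real (card G) / \<delta> * exp ?e \<longleftrightarrow> W T g \<omega> \<le> exp ?e / \<delta>"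
    unfolding W_eq_exp using card assms by (simp add: field_simps)
  finally show ?thesis .
qed

text \<open>All weights are positive, so the total dominates each of them. A single use of Markov's
  inequality thus handles all tests at once, without a union bound.\<close>

lemma prob_all_weights_le:
  assumes "0 < \<delta>"
  shows "prob {\<omega> \<in> space M. \<forall>g\<in>G. W T g \<omega> \<le> exp (2 * real T / (real N)\<^sup>2) / \<delta>} \<ge> 1 - \<delta>"
proof -
  let ?R = "\<lambda>\<omega>. \<Sum>g\<in>G. W T g \<omega>" and ?c = "exp (2 * real T / (real N)\<^sup>2)"
  have int: "integrable M ?R" by (intro Bochner_Integration.integrable_sum W_integrable) auto
  have [measurable]: "\<And>g. g \<in> G \<Longrightarrow> W T g \<in> borel_measurable M" "?R \<in> borel_measurable M"
    using W_measurable_M int by auto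
  have "prob {\<omega> \<in> space M. ?R \<omega> \<ge> ?c / \<delta>} \<le> expectation ?R / (?c / \<delta>)"
    using assms by (intro integral_Markov_inequality_measure[OF int, of "{}", simplified])
      (auto intro!: AE_I2 sum_nonneg less_imp_le[OF W_pos])
  also have "\<dots> \<le> ?c / (?c / \<delta>)"
    using assms expected_total_weight[of T] by (intro divide_right_mono) auto
  finally have markov: "prob {\<omega> \<in> space M. ?R \<omega> \<ge> ?c / \<delta>} \<le> \<delta>" using assms by simp
  have "1 - \<delta> \<le> 1 - prob {\<omega> \<in> space M. ?R \<omega> \<ge> ?c / \<delta>}" using markov by simp
  also have "\<dots> = prob (space M - {\<omega> \<in> space M. ?R \<omega> \<ge> ?c / \<delta>})"
    by (intro prob_compl[symmetric]) measurable
  also have "\<dots> \<le> prob {\<omega> \<in> space M. \<forall>g\<in>G. W T g \<omega> \<le> ?c / \<delta>}"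
  proof (intro finite_measure_mono subsetI)
    fix \<omega> assume \<omega>: "\<omega> \<in> space M - {\<omega> \<in> space M. ?R \<omega> \<ge> ?c / \<delta>}"
    have "W T g \<omega> \<le> ?R \<omega>" if "g \<in> G" for g
      using that finite_G less_imp_le[OF W_pos] by (intro member_le_sum) auto
    with \<omega> show "\<omega> \<in> {\<omega> \<in> space M. \<forall>g\<in>G. W T g \<omega> \<le> ?c / \<delta>}"
      by force
  next
    show "{\<omega> \<in> space M. \<forall>g\<in>G. W T g \<omega> \<le> ?c / \<delta>} \<in> events"
      using finite_G by measurable
  qed
  finally show ?thesis .
qed

end

theorem theorem3p3:
  fixes M :: "'w measure" and H :: "nat \<Rightarrow> 'w measure" and X :: "'x measure"
    and N T :: nat
    and G :: "('x \<times> real \<Rightarrow> real) set"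
    and \<eta> \<delta> :: real
    and x :: "nat \<Rightarrow> 'w \<Rightarrow> 'x" and \<psi> :: "nat \<Rightarrow> 'w \<Rightarrow> real pmf"
    and p y :: "nat \<Rightarrow> 'w \<Rightarrow> real"
  assumes "T \<ge> 1" and "N \<ge> 1"
    and "finite G" and "G \<noteq> {}"
    and "G \<subseteq> (space X \<times> grid N) \<rightarrow>\<^sub>E {-1..1}"
    and "\<And>g \<gamma>. g \<in> G \<Longrightarrow> \<gamma> \<in> grid N \<Longrightarrow> (\<lambda>\<xi>. g (\<xi>, \<gamma>)) \<in> borel_measurable X"
    and "0 < \<eta>" and "\<eta> \<le> 1 / 4"
    and "0 < \<delta>" and "\<delta> < 1"
    and "online_protocol M H X N T x \<psi> p y"
    and "runs_approachability M N T G \<eta> x \<psi> p y"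
  shows "measure M {\<omega> \<in> space M. \<forall>g\<in>G.
           Bias T (\<lambda>t. x t \<omega>) (\<lambda>t. p t \<omega>) (\<lambda>t. y t \<omega>) g
             \<le> 2 * \<eta> * Mass T (\<lambda>t. x t \<omega>) (\<lambda>t. p t \<omega>) g
               + (ln (real (card G) / \<delta>) + 2 * real T / (real N)\<^sup>2) / \<eta>}
         \<ge> 1 - \<delta>"
proof -
  interpret approachability_run M H X N T x \<psi> p y G \<eta>
    using assms by (intro approachability_run.intro approachability_run_axioms.intro) auto
  \<comment> \<open>Rewriting with the equivalence turns the event about biases into the event about
    final weights.\<close>
  show ?thesis
    using prob_all_weights_le[OF \<open>0 < \<delta>\<close>] by (simp only: bias_bound_iff[OF \<open>0 < \<delta>\<close>])
qed

end
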